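(* There exists an absolute constant $C>0$ such that the following holds. Assume that the noise is Gaussian and that $O=n\sum_{i=1}^re_ie_i^\top$ with $r=n/4$. Then for any $\theta\in\mathbb{R}^p$ such that $\|\theta\|^2\le\sqrt n$, $$\mathbf{E}\big(\mathcal{R}_\Sigma(\hat\eta_{\mathrm{LDA}})\big)\wedge\mathbf{E}\big(\mathcal{R}_\Sigma(\hat\eta_{\mathrm{ave}})\big)\ \ge\ C,$$ where $a\wedge b=\min(a,b)$.
   Context: Contamination model (Gaussian noise, identity covariance $\Sigma=\mathbf{I}_p$). $n,p\ge1$ are integers with $n/4$ an integer at most $p$. The clean training observations are $Y_i=\theta\eta_i+W_i\in\mathbb{R}^p$, $i=1,\dots,n$, with $\theta\in\mathbb{R}^p$, $\eta=(\eta_1,\dots,\eta_n)^\top\in\{-1,1\}^n$ a label vector not depending on the noise, and $W_i$ i.i.d. $\mathcal{N}(0,\Sigma)$, $\Sigma=\mathbf{I}_p$. The observed training data are the corrupted pairs $(\tilde Y_i,\eta_i)$ with $$\tilde Y_i=Y_i+O^{1/2}\epsilon_i=\eta_i\theta+W_i+O^{1/2}\epsilon_i,\quad i=1,\dots,n,$$ with $\epsilon_i$ i.i.d. $\mathcal{N}(0,\mathbf{I}_p)$ independent of $(Y_i)$, and $O$ a diagonal positive semidefinite corruption matrix in the canonical basis $(e_1,\dots,e_p)$ of $\mathbb{R}^p$. The new observation to be classified is not corrupted: $Y_{n+1}=\theta\eta_{n+1}+W_{n+1}$, with $\eta_{n+1}$ uniform on $\{-1,1\}$, $W_{n+1}\sim\mathcal{N}(0,\Sigma)$,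 all independent of each other and of the training data. The classifiers are built from the corrupted data: $\hat\eta_{\mathrm{ave}}(y)=\operatorname{sign}\big(\big\langle\sum_{i=1}^n\tilde Y_i\eta_i,\,y\big\rangle\big)$ and $\hat\eta_{\mathrm{LDA}}(y)=\operatorname{sign}\big(\big\langle\Sigma^{-1}\sum_{i=1}^n\tilde Y_i\eta_i,\,y\big\rangle\big)$ with $\Sigma=\mathbf{I}_p$. The risk $\mathcal{R}_\Sigma(\hat\eta)$ is the conditional probability, given the training data $(\tilde Y_i,\eta_i)_{i\le n}$, that $\hat\eta(Y_{n+1})\neq\eta_{n+1}$. $\|\cdot\|$ is the Euclidean norm. *)

theory Defs
  imports "HOL-Probability.Probability" "Jordan_Normal_Form.Gauss_Jordan_Elimination"
begin

no_notation inner (infix "\<bullet>" 70)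
no_notation vec_nth (infixl "$" 90)

text \<open>
  The dimensions n and p vary inside the statement, so vectors and matrices are those of
  Jordan_Normal_Form. Vector indices and observation indices start at 0: the training sample is
  i < n, the coordinates are j < p.
\<close>

definition std_gaussian :: "'i set \<Rightarrow> ('i \<Rightarrow> real) measure" where
  "std_gaussian I = (\<Pi>\<^sub>M i\<in>I. density lborel (\<lambda>x. ennreal (std_normal_density x)))"

text \<open>
  The model is realised on its canonical product space. A sample point is
  ((W, eps), (W_new, eta_new)), where W and eps are n x p arrays with independent N(0,1) entries
  (row i is an N(0, I_p) vector), W_new consists of p independent N(0,1) entries, eta_new is uniform
  on {-1, 1}, and the four components are independent.
\<close>

type_synonym sample = "((nat \<times> nat \<Rightarrow> real) \<times> (nat \<times> nat \<Rightarrow> real)) \<times> ((nat \<Rightarrow> real) \<times> real)"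

definition model :: "nat \<Rightarrow> nat \<Rightarrow> sample measure" where
  "model n p =
     (std_gaussian ({..<n} \<times> {..<p}) \<Otimes>\<^sub>M std_gaussian ({..<n} \<times> {..<p})) \<Otimes>\<^sub>M
     (std_gaussian {..<p} \<Otimes>\<^sub>M measure_pmf (pmf_of_set {-1, 1}))"

definition noise :: "nat \<Rightarrow> nat \<Rightarrow> sample \<Rightarrow> real vec" where
  "noise p i \<omega> = vec p (\<lambda>j. fst (fst \<omega>) (i, j))"

definition corruption_noise :: "nat \<Rightarrow> nat \<Rightarrow> sample \<Rightarrow> real vec" where
  "corruption_noise p i \<omega> = vec p (\<lambda>j. snd (fst \<omega>) (i, j))"

definition new_noise :: "nat \<Rightarrow> sample \<Rightarrow> real vec" where
  "new_noise p \<omega> = vec p (fst (snd \<omega>))"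

definition new_label :: "sample \<Rightarrow> real" where
  "new_label \<omega> = snd (snd \<omega>)"

text \<open>
  The square root of a positive semidefinite diagonal matrix; it is only meant for such matrices.
\<close>

definition diag_sqrt :: "real mat \<Rightarrow> real mat" where
  "diag_sqrt A = mat_diag (dim_row A) (\<lambda>j. sqrt (A $$ (j, j)))"

lemma diag_sqrt_square:
  assumes "A \<in> carrier_mat p p" "diagonal_mat A" "\<And>j. j < p \<Longrightarrow> A $$ (j, j) \<ge> 0"
  shows "diag_sqrt A * diag_sqrt A = A"
proof -
  have "diag_sqrt A * diag_sqrt A = mat_diag p (\<lambda>j. sqrt (A $$ (j, j)) * sqrt (A $$ (j, j)))"
    using assms(1) by (simp add: diag_sqrt_def del: real_sqrt_mult_self)
  then show ?thesis
    using assms by (auto simp: diagonal_mat_def mat_diag_def intro!: eq_matI)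
qed

text \<open>The matrix n times the sum over i < r of the outer products of e_i with itself.\<close>

definition corruption_matrix :: "nat \<Rightarrow> nat \<Rightarrow> nat \<Rightarrow> real mat" where
  "corruption_matrix n p r =
     real n \<cdot>\<^sub>m mat p p (\<lambda>(j, k). \<Sum>i<r. unit_vec p i $ j * unit_vec p i $ k)"

definition clean_obs :: "nat \<Rightarrow> real vec \<Rightarrow> real vec \<Rightarrow> nat \<Rightarrow> sample \<Rightarrow> real vec" where
  "clean_obs p \<theta> \<eta> i \<omega> = \<eta> $ i \<cdot>\<^sub>v \<theta> + noise p i \<omega>"

definition corrupted_obs ::
    "nat \<Rightarrow> real mat \<Rightarrow> real vec \<Rightarrow> real vec \<Rightarrow> nat \<Rightarrow> sample \<Rightarrow> real vec" where
  "corrupted_obs p A \<theta> \<eta> i \<omega> =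
     clean_obs p \<theta> \<eta> i \<omega> + diag_sqrt A *\<^sub>v corruption_noise p i \<omega>"

definition new_obs :: "nat \<Rightarrow> real vec \<Rightarrow> sample \<Rightarrow> real vec" where
  "new_obs p \<theta> \<omega> = new_label \<omega> \<cdot>\<^sub>v \<theta> + new_noise p \<omega>"

text \<open>
  A classification rule sends the training observations (a family indexed by i < n) and a new point
  to a predicted label. The value sgn 0 = 0 agrees with no label.
\<close>

definition ave_rule ::
    "nat \<Rightarrow> nat \<Rightarrow> real vec \<Rightarrow> (nat \<Rightarrow> real vec) \<Rightarrow> real vec \<Rightarrow> real" where
  "ave_rule n p \<eta> Y y = sgn (finsum_vec TYPE(real) p (\<lambda>i. \<eta> $ i \<cdot>\<^sub>v Y i) {..<n} \<bullet> y)"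

definition lda_rule ::
    "nat \<Rightarrow> nat \<Rightarrow> real mat \<Rightarrow> real vec \<Rightarrow> (nat \<Rightarrow> real vec) \<Rightarrow> real vec \<Rightarrow> real" where
  "lda_rule n p \<Sigma> \<eta> Y y =
     sgn ((the (mat_inverse \<Sigma>) *\<^sub>v finsum_vec TYPE(real) p (\<lambda>i. \<eta> $ i \<cdot>\<^sub>v Y i) {..<n}) \<bullet> y)"

text \<open>
  The sigma-algebra generated by the corrupted training observations; the training labels are
  deterministic and contribute nothing to it.
\<close>

definition training_algebra ::
    "nat \<Rightarrow> nat \<Rightarrow> real mat \<Rightarrow> real vec \<Rightarrow> real vec \<Rightarrow> sample measure" where
  "training_algebra n p A \<theta> \<eta> =
     vimage_algebra (space (model n p))
       (\<lambda>\<omega>. \<lambda>(i, j)\<in>{..<n} \<times> {..<p}. corrupted_obs p A \<theta> \<eta> i \<omega> $ j)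
       (\<Pi>\<^sub>M ij\<in>{..<n} \<times> {..<p}. borel)"

definition risk ::
    "nat \<Rightarrow> nat \<Rightarrow> real mat \<Rightarrow> real vec \<Rightarrow> real vec \<Rightarrow>
     ((nat \<Rightarrow> real vec) \<Rightarrow> real vec \<Rightarrow> real) \<Rightarrow> sample \<Rightarrow> real" where
  "risk n p A \<theta> \<eta> rule =
     real_cond_exp (model n p) (training_algebra n p A \<theta> \<eta>)
       (indicator {\<omega> \<in> space (model n p).
          rule (\<lambda>i. corrupted_obs p A \<theta> \<eta> i \<omega>) (new_obs p \<theta> \<omega>) \<noteq> new_label \<omega>})"

end

theory Submission
  imports Defs
begin

text \<open>
  The expectation of a conditional probability is the unconditional probability, and for the identity
  covariance both rules predict the sign of the same score, so one bound on a misclassification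
  probability suffices. Multiply the score by the new label \<open>l\<close> (with \<open>w\<close> the new noise). As all
  labels square to one, the result is
  \<open>n \<parallel>\<theta>\<parallel>\<^sup>2 + n \<langle>l \<theta>, w\<rangle> + (a linear form in the clean noise) + (a linear form in the corruption noise)\<close>
  (lemma \<open>label_times_score\<close>), and the prediction is wrong as soon as this is at most \<open>0\<close>.

  The first term is at most \<open>n powr (3/2)\<close>, by the hypothesis on \<open>\<theta>\<close>. The last one is, given the
  new observation, a centred Gaussian whose variance is \<open>n\<^sup>2\<close> times the squared norm of the first
  \<open>r = n / 4\<close> coordinates of \<open>\<theta> + l w\<close>. That norm is typically at least of order \<open>sqrt r\<close>, whatever \<open>\<theta>\<close> is,
  so the corruption alone has standard deviation at least of order \<open>n powr (3/2)\<close> and outweighs the signal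
  with a probability bounded below.

  The middle two terms are handled by sign, since no sharp constant is wanted. The new observation is required to satisfy \<open>\<langle>l \<theta>, w\<rangle> \<le> 0\<close> and to
  have a shifted norm that is not small (\<open>gaussian_linear_form_tail\<close> with threshold \<open>0\<close>, and
  \<open>std_gaussian_shifted_norm_small\<close>); given such an observation, the form in the clean noise is
  required to be at most \<open>0\<close> and the independent form in the corruption noise to be at most
  \<open>- n \<parallel>\<theta>\<parallel>\<^sup>2\<close>. The probabilities multiply by Fubini (\<open>measure_pair_ge_of_sections\<close>).
\<close>

section \<open>Gaussian product measures\<close>

abbreviation std_normal :: "real measure" where
  "std_normal \<equiv> density lborel (\<lambda>x. ennreal (std_normal_density x))"

text \<open>
  The mass below \<open>-K\<close>, so that an event which has to overcome a signal of \<open>K\<close> standard deviations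
  has this probability.
\<close>

definition std_normal_tail :: "real \<Rightarrow> real" where
  "std_normal_tail K = measure std_normal {..-K}"

lemma prob_space_std_normal: "prob_space std_normal"
  by (rule prob_space_normal_density) simp

lemma prob_space_std_gaussian: "prob_space (std_gaussian I)"
  unfolding std_gaussian_def by (intro prob_space_PiM prob_space_std_normal)

lemma std_normal_tail_pos: "std_normal_tail K > 0"
proof -
  interpret prob_space std_normal by (rule prob_space_std_normal)
  have "{..-K} \<notin> null_sets std_normal"
  proof
    assume "{..-K} \<in> null_sets std_normal"
    then have "AE x in lborel. x \<in> {..-K} \<longrightarrow> ennreal (std_normal_density x) = 0"
      by (subst (asm) null_sets_density_iff) auto
    then have "AE x in lborel. x \<notin> {..-K}"
      by eventually_elim (use normal_density_pos[of 1 0] in \<open>auto simp: ennreal_eq_0_iff not_le[symmetric]\<close>)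
    then have "{..-K} \<in> null_sets lborel"
      by (subst (asm) AE_iff_null) (auto simp: atMost_def)
    then have "emeasure lborel {..-K} = 0" by auto
    moreover have "ennreal 1 \<le> emeasure lborel {..-K}"
      using emeasure_mono[of "{-K-1..-K}" "{..-K}" lborel] by simp
    ultimately show False by simp
  qed
  then have "measure std_normal {..-K} \<noteq> 0"
    by (auto simp: null_sets_def emeasure_eq_measure)
  then show ?thesis
    unfolding std_normal_tail_def using measure_nonneg[of std_normal "{..-K}"] by linarith
qed

lemma distributed_coordinate_std_gaussian:
  assumes "i \<in> I"
  shows "distributed (std_gaussian I) lborel (\<lambda>x. x i) (std_normal_density)"
proof -
  have "distr (std_gaussian I) std_normal (\<lambda>x. x i) = std_normal"
    unfolding std_gaussian_def
    by (rule distr_PiM_component[OF prob_space_std_normal assms])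
  moreover have "distr (std_gaussian I) std_normal (\<lambda>x. x i) = distr (std_gaussian I) lborel (\<lambda>x. x i)"
    by (rule distr_cong) auto
  moreover have "(\<lambda>x. x i) \<in> measurable (std_gaussian I) lborel"
    using measurable_component_singleton[OF assms, of "\<lambda>_. std_normal"]
    unfolding std_gaussian_def by simp
  ultimately show ?thesis
    by (simp add: distributed_def)
qed

lemma measurable_coordinate_std_gaussian:
  assumes "i \<in> I"
  shows "(\<lambda>x. x i) \<in> borel_measurable (std_gaussian I)"
  using distributed_coordinate_std_gaussian[OF assms] unfolding distributed_def by simp

lemma indep_vars_coordinates_std_gaussian:
  assumes "J \<noteq> {}" "J \<subseteq> I"
  shows "prob_space.indep_vars (std_gaussian I) (\<lambda>_. borel) (\<lambda>i x. x i) J"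
proof -
  interpret prob_space "std_gaussian I" by (rule prob_space_std_gaussian)
  have I: "I \<noteq> {}" using assms by auto
  have "indep_vars (\<lambda>_. borel) (\<lambda>i x. x i) I"
  proof (subst indep_vars_iff_distr_eq_PiM'[OF I])
    show "\<And>i. i \<in> I \<Longrightarrow> random_variable borel (\<lambda>x. x i)"
      by (rule measurable_coordinate_std_gaussian)
    have "distr (std_gaussian I) (Pi\<^sub>M I (\<lambda>_. borel)) (\<lambda>x. restrict (\<lambda>i. x i) I)
        = distr (std_gaussian I) (std_gaussian I) (\<lambda>x. x)"
      by (rule distr_cong)
        (auto simp: std_gaussian_def space_PiM intro!: sets_PiM_cong)
    also have "\<dots> = std_gaussian I" by simp
    also have "\<dots> = (\<Pi>\<^sub>M i\<in>I. distr (std_gaussian I) borel (\<lambda>x. x i))"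
      unfolding std_gaussian_def[of I, folded]
    proof (rule PiM_cong)
      fix i assume i: "i \<in> I"
      have "distr (std_gaussian I) borel (\<lambda>x. x i) = distr (std_gaussian I) lborel (\<lambda>x. x i)"
        by (rule distr_cong) auto
      then show "std_normal = distr (Pi\<^sub>M I (\<lambda>i. std_normal)) borel (\<lambda>x. x i)"
        using distributed_coordinate_std_gaussian[OF i]
        unfolding distributed_def std_gaussian_def by simp
    qed simp
    finally show "distr (std_gaussian I) (Pi\<^sub>M I (\<lambda>_. borel)) (\<lambda>x. restrict (\<lambda>i. x i) I) = 
        (\<Pi>\<^sub>M i\<in>I. distr (std_gaussian I) borel (\<lambda>x. x i))" .
  qed
  then show ?thesis
    by (rule indep_vars_subset[OF _ assms(2)])
qed

text \<open>
  A nondegenerate linear form is a centred Gaussian with standard deviation the Euclidean norm of its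
  coefficients. The degenerate form is identically \<open>0\<close>, and then the hypothesis forces \<open>t \<le> 0\<close>.
  With \<open>t = 0\<close> and \<open>K = 0\<close> this bounds from below the probability that a linear form is nonpositive.
\<close>

lemma gaussian_linear_form_tail:
  assumes "finite I" and t: "t \<le> K * sqrt (\<Sum>i\<in>I. (c i)\<^sup>2)"
  shows "std_normal_tail K \<le>
    measure (std_gaussian I) {x \<in> space (std_gaussian I). (\<Sum>i\<in>I. c i * x i) \<le> - t}"
proof -
  interpret prob_space "std_gaussian I" by (rule prob_space_std_gaussian)
  have form_m: "(\<lambda>x. \<Sum>i\<in>I. c i * x i) \<in> borel_measurable (std_gaussian I)"
    by (intro borel_measurable_sum borel_measurable_times borel_measurable_const
        measurable_coordinate_std_gaussian)
  \<comment> \<open>The sum rule for independent Gaussians wants positive variances.\<close>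
  define J where "J = {i\<in>I. c i \<noteq> 0}"
  have J: "finite J" "J \<subseteq> I" using assms by (auto simp: J_def)
  have sum_J: "(\<Sum>i\<in>I. c i * x i) = (\<Sum>i\<in>J. c i * x i)" for x
    using assms(1) by (intro sum.mono_neutral_right) (auto simp: J_def)
  have sq_J: "(\<Sum>i\<in>I. (c i)\<^sup>2) = (\<Sum>i\<in>J. \<bar>c i\<bar>\<^sup>2)"
    using assms(1) by (simp, intro sum.mono_neutral_right) (auto simp: J_def)
  show ?thesis
  proof (cases "J = {}")
    case True
    then have "t \<le> 0" using t sq_J by simp
    then have "{x \<in> space (std_gaussian I). (\<Sum>i\<in>I. c i * x i) \<le> - t} = space (std_gaussian I)"
      using sum_J True by simp
    moreover have "std_normal_tail K \<le> 1"
      unfolding std_normal_tail_def by (rule prob_space.prob_le_1[OF prob_space_std_normal])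
    ultimately show ?thesis using prob_space by simp
  next
    case False
    define s where "s = sqrt (\<Sum>i\<in>J. \<bar>c i\<bar>\<^sup>2)"
    have s: "s > 0"
      unfolding s_def using False J by (intro real_sqrt_gt_zero sum_pos) (auto simp: J_def)
    define X where "X = (\<lambda>x. \<Sum>i\<in>J. c i * x i)"
    have "distributed (std_gaussian I) lborel (\<lambda>x. 0 + c i * x i) (normal_density (0 + c i * 0) (\<bar>c i\<bar> * 1))"
      if "i \<in> J" for i
      by (rule normal_density_affine)
        (use that J in \<open>auto simp: J_def intro!: distributed_coordinate_std_gaussian\<close>)
    then have d: "distributed (std_gaussian I) lborel (\<lambda>x. c i * x i) (normal_density 0 \<bar>c i\<bar>)"
      if "i \<in> J" for i using that by simp
    have "indep_vars (\<lambda>_. borel) (\<lambda>i x. c i * x i) J"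
      by (rule indep_vars_compose2[OF indep_vars_coordinates_std_gaussian[OF False J(2)]]) simp
    then have "distributed (std_gaussian I) lborel X (normal_density (\<Sum>i\<in>J. 0) s)"
      unfolding s_def X_def by (intro sum_indep_normal J False d) (auto simp: J_def)
    then have std: "distributed (std_gaussian I) lborel (\<lambda>x. (X x - 0) / s) std_normal_density"
      by (subst normal_standard_normal_convert[OF s, symmetric]) simp
    then have std': "distributed (std_gaussian I) lborel (\<lambda>x. X x / s) std_normal_density"
      by (simp only: diff_0_right)
    have Xm: "(\<lambda>x. X x / s) \<in> borel_measurable (std_gaussian I)"
      using distributed_measurable[OF std'] by (simp only: measurable_lborel1 measurable_lborel2)
    have "std_normal_tail K = measure (distr (std_gaussian I) lborel (\<lambda>x. X x / s)) {..-K}"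
      unfolding std_normal_tail_def distributed_distr_eq_density[OF std'] ..
    also have "\<dots> = measure (std_gaussian I) {x \<in> space (std_gaussian I). X x / s \<le> - K}"
      using Xm by (subst measure_distr) (auto intro!: arg_cong[where f="measure _"])
    also have "\<dots> \<le> measure (std_gaussian I) {x \<in> space (std_gaussian I). (\<Sum>i\<in>I. c i * x i) \<le> - t}"
    proof (rule finite_measure_mono)
      have "X x \<le> - t" if "X x / s \<le> - K" for x
      proof -
        have "X x \<le> - K * s" using that s by (simp only: pos_divide_le_eq)
        then show ?thesis using t sq_J by (simp add: s_def)
      qed
      then show "{x \<in> space (std_gaussian I). X x / s \<le> - K}
          \<subseteq> {x \<in> space (std_gaussian I). (\<Sum>i\<in>I. c i * x i) \<le> - t}"
        by (auto simp: sum_J X_def)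
      show "{x \<in> space (std_gaussian I). (\<Sum>i\<in>I. c i * x i) \<le> - t} \<in> events"
        using form_m by measurable
    qed
    finally show ?thesis .
  qed
qed

text \<open>The standard normal density is at most \<open>1\<close>.\<close>

lemma std_gaussian_coordinate_small_ball:
  assumes "i \<in> I" "a \<ge> 0"
  shows "measure (std_gaussian I) {x \<in> space (std_gaussian I). \<bar>x i - b\<bar> < a} \<le> 2 * a"
proof -
  interpret N: prob_space std_normal by (rule prob_space_std_normal)
  have "measure (std_gaussian I) {x \<in> space (std_gaussian I). \<bar>x i - b\<bar> < a}
      = measure (distr (std_gaussian I) lborel (\<lambda>x. x i)) {b-a<..<b+a}"
    using measurable_coordinate_std_gaussian[OF assms(1)]
    by (subst measure_distr) (auto intro!: arg_cong[where f="measure _"])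
  also have "\<dots> = measure std_normal {b-a<..<b+a}"
    using distributed_coordinate_std_gaussian[OF assms(1)] unfolding distributed_def by simp
  also have "\<dots> \<le> 2 * a"
  proof -
    have dens: "std_normal_density x \<le> 1" for x
    proof -
      have "1 \<le> sqrt (2 * pi)" using pi_gt3 by simp
      then have "1 / sqrt (2 * pi) \<le> 1" by simp
      moreover have "exp (- x\<^sup>2 / 2) \<le> 1" by simp
      ultimately have "1 / sqrt (2 * pi) * exp (- x\<^sup>2 / 2) \<le> 1 * 1"
        by (intro mult_mono) auto
      then show ?thesis by (simp add: normal_density_def)
    qed
    have "emeasure std_normal {b-a<..<b+a}
        = (\<integral>\<^sup>+ x. ennreal (std_normal_density x) * indicator {b-a<..<b+a} x \<partial>lborel)"
      by (subst emeasure_density) auto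
    also have "\<dots> \<le> (\<integral>\<^sup>+ x. indicator {b-a<..<b+a} x \<partial>lborel)"
      by (intro nn_integral_mono) (auto simp: indicator_def dens ennreal_le_1)
    also have "\<dots> = ennreal (2 * a)" using assms(2) by simp
    finally show ?thesis
      using assms(2) by (simp add: N.emeasure_eq_measure)
  qed
  finally show ?thesis .
qed

text \<open>
  If the sum is this small, at least half of the coordinates lie within \<open>a\<close> of the shift. Each one
  does so with probability at most \<open>2 * a\<close>, so Markov's inequality for their number gives the bound.
  It is uniform in the shift and in the dimension.
\<close>

lemma std_gaussian_shifted_norm_small:
  assumes "finite J" "J \<noteq> {}" "J \<subseteq> I" "a > 0"
  shows "measure (std_gaussian I)
    {x \<in> space (std_gaussian I). (\<Sum>j\<in>J. (x j - b j)\<^sup>2) \<le> a\<^sup>2 * real (card J) / 2} \<le> 4 * a"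
proof -
  interpret prob_space "std_gaussian I" by (rule prob_space_std_gaussian)
  define B where "B j = {x \<in> space (std_gaussian I). \<bar>x j - b j\<bar> < a}" for j
  define N where "N x = (\<Sum>j\<in>J. indicator (B j) x :: real)" for x
  have m: "(\<lambda>x. x j) \<in> borel_measurable (std_gaussian I)" if "j \<in> J" for j
    using that assms(3) by (intro measurable_coordinate_std_gaussian) auto
  have B: "B j \<in> events" if "j \<in> J" for j
    unfolding B_def using m[OF that] by measurable
  have int: "integrable (std_gaussian I) N"
    unfolding N_def using B by (intro Bochner_Integration.integrable_sum integrable_real_indicator) (auto simp: emeasure_eq_measure)
  have N_nonneg: "N x \<ge> 0" for x
    unfolding N_def by (intro sum_nonneg) simp
  have card: "real (card J) > 0" using assms by (simp add: card_gt_0_iff)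
  have "expectation N = (\<Sum>j\<in>J. prob (B j))"
    unfolding N_def using B
    by (subst Bochner_Integration.integral_sum) (auto simp: emeasure_eq_measure intro!: integrable_real_indicator)
  also have "\<dots> \<le> (\<Sum>j\<in>J. 2 * a)"
    unfolding B_def using assms by (intro sum_mono std_gaussian_coordinate_small_ball) auto
  finally have EN: "expectation N \<le> 2 * a * card J" by (simp add: mult_ac)
  have "{x \<in> space (std_gaussian I). (\<Sum>j\<in>J. (x j - b j)\<^sup>2) \<le> a\<^sup>2 * real (card J) / 2}
      \<subseteq> {x \<in> space (std_gaussian I). N x \<ge> real (card J) / 2}"
  proof safe
    fix x assume x: "x \<in> space (std_gaussian I)"
      and le: "(\<Sum>j\<in>J. (x j - b j)\<^sup>2) \<le> a\<^sup>2 * real (card J) / 2"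
    have "a\<^sup>2 * (card J - N x) = (\<Sum>j\<in>J. a\<^sup>2 * (1 - indicator (B j) x))"
      by (simp add: N_def sum_subtractf sum_distrib_left algebra_simps)
    also have "\<dots> \<le> (\<Sum>j\<in>J. (x j - b j)\<^sup>2)"
    proof (rule sum_mono)
      fix j
      show "a\<^sup>2 * (1 - indicator (B j) x) \<le> (x j - b j)\<^sup>2"
        using x assms(4) abs_le_square_iff[of a "x j - b j"] by (auto simp: B_def indicator_def)
    qed
    also have "\<dots> \<le> a\<^sup>2 * (real (card J) / 2)" using le by simp
    finally show "real (card J) / 2 \<le> N x"
      using assms(4) by (simp add: mult_le_cancel_left)
  qed
  then have "measure (std_gaussian I)
    {x \<in> space (std_gaussian I). (\<Sum>j\<in>J. (x j - b j)\<^sup>2) \<le> a\<^sup>2 * real (card J) / 2}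
     \<le> prob {x \<in> space (std_gaussian I). N x \<ge> real (card J) / 2}"
    using int by (intro finite_measure_mono) auto
  also have "\<dots> \<le> expectation N / (real (card J) / 2)"
    by (rule integral_Markov_inequality_measure[where A="{}"])
      (use int card N_nonneg in auto)
  also have "\<dots> \<le> (2 * a * card J) / (real (card J) / 2)"
    using EN card by (intro divide_right_mono) auto
  also have "\<dots> = 4 * a" using card by simp
  finally show ?thesis .
qed

section \<open>Lower bounds on a product space from its sections\<close>

lemma measure_pair_ge_of_sections:
  assumes "prob_space M" "prob_space N"
    and Q: "Q \<in> sets (M \<Otimes>\<^sub>M N)" and A: "A \<in> sets N"
    and \<alpha>: "\<alpha> \<le> measure N A" and "\<beta> \<ge> 0"
    and \<beta>: "\<And>y. y \<in> A \<Longrightarrow> \<beta> \<le> measure M ((\<lambda>x. (x, y)) -` Q)"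
  shows "\<alpha> * \<beta> \<le> measure (M \<Otimes>\<^sub>M N) Q"
proof -
  interpret M: prob_space M by fact
  interpret N: prob_space N by fact
  interpret P: pair_prob_space M N ..
  have "ennreal (\<beta> * measure N A) = (\<integral>\<^sup>+y. ennreal \<beta> * indicator A y \<partial>N)"
    using A assms(6) by (simp add: nn_integral_cmult_indicator N.emeasure_eq_measure ennreal_mult)
  also have "\<dots> \<le> (\<integral>\<^sup>+y. emeasure M ((\<lambda>x. (x, y)) -` Q) \<partial>N)"
    using \<beta> by (intro nn_integral_mono) (auto simp: indicator_def M.emeasure_eq_measure intro!: ennreal_leI)
  also have "\<dots> = emeasure (M \<Otimes>\<^sub>M N) Q"
    by (rule P.emeasure_pair_measure_alt2[OF Q, symmetric])
  finally have "\<beta> * measure N A \<le> measure (M \<Otimes>\<^sub>M N) Q"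
    using assms(6) by (simp add: P.emeasure_eq_measure)
  moreover have "\<alpha> * \<beta> \<le> \<beta> * measure N A"
    using mult_left_mono[OF \<alpha> assms(6)] by (simp add: mult.commute)
  ultimately show ?thesis by linarith
qed

lemma measure_pair_Times:
  assumes "prob_space M" "prob_space N" "A \<in> sets M" "B \<in> sets N"
  shows "measure (M \<Otimes>\<^sub>M N) (A \<times> B) = measure M A * measure N B"
proof -
  interpret N: prob_space N by fact
  show ?thesis
    using N.emeasure_pair_measure_Times[OF assms(3,4)] by (simp add: measure_def enn2real_mult)
qed

section \<open>The contaminated model\<close>

lemma prob_space_model: "prob_space (model n p)"
proof -
  interpret A: prob_space "std_gaussian I" for I :: "(nat \<times> nat) set" by (rule prob_space_std_gaussian)
  interpret B: prob_space "std_gaussian {..<p}" by (rule prob_space_std_gaussian)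
  interpret L: prob_space "measure_pmf (pmf_of_set {-1, 1::real})" by (rule prob_space_measure_pmf)
  interpret AA: pair_prob_space "std_gaussian ({..<n} \<times> {..<p})" "std_gaussian ({..<n} \<times> {..<p})" ..
  interpret BL: pair_prob_space "std_gaussian {..<p}" "measure_pmf (pmf_of_set {-1, 1::real})" ..
  interpret P: pair_prob_space
    "std_gaussian ({..<n} \<times> {..<p}) \<Otimes>\<^sub>M std_gaussian ({..<n} \<times> {..<p})"
    "std_gaussian {..<p} \<Otimes>\<^sub>M measure_pmf (pmf_of_set {-1, 1::real})" ..
  show ?thesis unfolding model_def by (rule P.prob_space_axioms)
qed

lemma measurable_model_coordinates:
  shows "i < n \<Longrightarrow> j < p \<Longrightarrow> (\<lambda>\<omega>. fst (fst \<omega>) (i, j)) \<in> borel_measurable (model n p)"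
    and "i < n \<Longrightarrow> j < p \<Longrightarrow> (\<lambda>\<omega>. snd (fst \<omega>) (i, j)) \<in> borel_measurable (model n p)"
    and "j < p \<Longrightarrow> (\<lambda>\<omega>. fst (snd \<omega>) j) \<in> borel_measurable (model n p)"
    and "(\<lambda>\<omega>. snd (snd \<omega>)) \<in> borel_measurable (model n p)"
proof -
  note c = measurable_coordinate_std_gaussian
  show "(\<lambda>\<omega>. fst (fst \<omega>) (i, j)) \<in> borel_measurable (model n p)" if "i < n" "j < p"
    using that unfolding model_def
    by (intro measurable_compose[OF measurable_compose[OF measurable_fst measurable_fst] c]) auto
  show "(\<lambda>\<omega>. snd (fst \<omega>) (i, j)) \<in> borel_measurable (model n p)" if "i < n" "j < p"
    using that unfolding model_def
    by (intro measurable_compose[OF measurable_compose[OF measurable_fst measurable_snd] c]) auto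
  show "(\<lambda>\<omega>. fst (snd \<omega>) j) \<in> borel_measurable (model n p)" if "j < p"
    using that unfolding model_def
    by (intro measurable_compose[OF measurable_compose[OF measurable_snd measurable_fst] c]) auto
  have id: "(\<lambda>x. x) \<in> borel_measurable (measure_pmf (pmf_of_set {-1, 1::real}))" by simp
  show "(\<lambda>\<omega>. snd (snd \<omega>)) \<in> borel_measurable (model n p)"
    unfolding model_def
    by (rule measurable_compose[OF measurable_compose[OF measurable_snd measurable_snd] id])
qed

text \<open>
  The inner product whose sign both rules report, written out in coordinates; \<open>d\<close> is the diagonal of
  the square root of the corruption matrix, \<open>h\<close> are the training labels and \<open>t\<close> is the mean vector.
\<close>

definition score ::
    "nat \<Rightarrow> nat \<Rightarrow> (nat \<Rightarrow> real) \<Rightarrow> (nat \<Rightarrow> real) \<Rightarrow> (nat \<Rightarrow> real) \<Rightarrow> sample \<Rightarrow> real" where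
  "score n p d h t \<omega> =
     (\<Sum>j<p. (\<Sum>i<n. h i * (h i * t j + fst (fst \<omega>) (i, j) + d j * snd (fst \<omega>) (i, j))) *
        (snd (snd \<omega>) * t j + fst (snd \<omega>) j))"

lemma measurable_score: "score n p d h t \<in> borel_measurable (model n p)"
  unfolding score_def
  by (intro borel_measurable_sum borel_measurable_times borel_measurable_add
      borel_measurable_const measurable_model_coordinates) auto

text \<open>
  Given the new observation, the two noise arrays enter linearly and separately. This is what makes
  the conditional misclassification event contain a product of two half spaces.
\<close>

lemma label_times_score:
  assumes "l * l = 1" "\<And>i. i < n \<Longrightarrow> h i * h i = 1"
  shows "l * score n p d h t ((W, E), (w, l)) =
    real n * (\<Sum>j<p. (t j)\<^sup>2) + real n * (\<Sum>j<p. (l * t j) * w j)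
    + (\<Sum>ij\<in>{..<n} \<times> {..<p}. h (fst ij) * (t (snd ij) + l * w (snd ij)) * W ij)
    + (\<Sum>ij\<in>{..<n} \<times> {..<p}. h (fst ij) * d (snd ij) * (t (snd ij) + l * w (snd ij)) * E ij)"
proof -
  have "l * score n p d h t ((W, E), (w, l)) =
    (\<Sum>j<p. (\<Sum>i<n. h i * (h i * t j + W (i, j) + d j * E (i, j))) * (l * l * t j + l * w j))"
    unfolding score_def by (simp add: sum_distrib_left algebra_simps)
  also have "\<dots> = (\<Sum>j<p. (\<Sum>i<n. h i * (h i * t j + W (i, j) + d j * E (i, j))) * (t j + l * w j))"
    using assms(1) by simp
  also have "\<dots> = (\<Sum>j<p. \<Sum>i<n. t j * (t j + l * w j) + h i * (t j + l * w j) * W (i, j)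
      + h i * d j * (t j + l * w j) * E (i, j))"
  proof -
    have "h i * (h i * t j + W (i, j) + d j * E (i, j)) * (t j + l * w j)
      = t j * (t j + l * w j) + h i * (t j + l * w j) * W (i, j)
      + h i * d j * (t j + l * w j) * E (i, j)" if "i < n" for i j
    proof -
      have "h i * (h i * t j + W (i, j) + d j * E (i, j)) * (t j + l * w j)
        = (h i * h i) * t j * (t j + l * w j) + h i * (t j + l * w j) * W (i, j)
        + h i * d j * (t j + l * w j) * E (i, j)" by (simp add: algebra_simps)
      then show ?thesis using assms(2)[OF that] by simp
    qed
    then show ?thesis unfolding sum_distrib_right by (intro sum.cong refl) auto
  qed
  also have "\<dots> = (\<Sum>j<p. \<Sum>i<n. t j * (t j + l * w j))
      + (\<Sum>j<p. \<Sum>i<n. h i * (t j + l * w j) * W (i, j))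
      + (\<Sum>j<p. \<Sum>i<n. h i * d j * (t j + l * w j) * E (i, j))"
    by (simp add: sum.distrib)
  also have "(\<Sum>j<p. \<Sum>i<n. t j * (t j + l * w j))
      = real n * (\<Sum>j<p. (t j)\<^sup>2) + real n * (\<Sum>j<p. (l * t j) * w j)"
    by (simp add: sum_distrib_left sum.distrib[symmetric] algebra_simps power2_eq_square)
  also have "(\<Sum>j<p. \<Sum>i<n. h i * (t j + l * w j) * W (i, j))
      = (\<Sum>ij\<in>{..<n} \<times> {..<p}. h (fst ij) * (t (snd ij) + l * w (snd ij)) * W ij)"
    by (subst sum.swap) (simp add: sum.cartesian_product case_prod_unfold)
  also have "(\<Sum>j<p. \<Sum>i<n. h i * d j * (t j + l * w j) * E (i, j))
      = (\<Sum>ij\<in>{..<n} \<times> {..<p}. h (fst ij) * d (snd ij) * (t (snd ij) + l * w (snd ij)) * E ij)"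
    by (subst sum.swap) (simp add: sum.cartesian_product case_prod_unfold)
  finally show ?thesis .
qed

text \<open>
  With this radius, the new observations of small shifted norm, which have probability at most
  \<open>4 * small_radius\<close>, take away at most half of the mass \<open>std_normal_tail 0\<close> that
  is guaranteed to those of the favourable sign.
\<close>

definition small_radius :: real where
  "small_radius = std_normal_tail 0 / 8"

text \<open>
  The factors are the probability of a favourable new observation, of a nonpositive clean noise
  term, and of a corruption term exceeding the signal. The signal is less than
  \<open>3 / small_radius\<close> conditional standard deviations of the corruption term: the squared ratio is at
  most \<open>n ^ 3\<close> divided by \<open>n\<^sup>2 * (small_radius\<^sup>2 * r / 2)\<close>, that is \<open>8 / small_radius\<^sup>2\<close>.
\<close>

definition error_bound :: real where
  "error_bound = std_normal_tail 0 / 2 * (std_normal_tail 0 * std_normal_tail (3 / small_radius))"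

lemma error_bound_pos: "error_bound > 0"
  unfolding error_bound_def using std_normal_tail_pos by simp

text \<open>
  The bound is obtained by conditioning on the new observation, not on the training sample: the
  dominating corruption term is then an explicit Gaussian.
\<close>

lemma misclassification_probability_ge:
  assumes n: "n = 4 * r" "r > 0" "r \<le> p"
    and h: "\<And>i. i < n \<Longrightarrow> h i \<in> {-1, 1}"
    and t: "(\<Sum>j<p. (t j)\<^sup>2) \<le> sqrt (real n)"
    and d: "\<And>j. j < p \<Longrightarrow> d j = (if j < r then sqrt (real n) else 0)"
  shows "error_bound \<le>
    measure (model n p) {\<omega> \<in> space (model n p). sgn (score n p d h t \<omega>) \<noteq> snd (snd \<omega>)}"
proof -
  define I where "I = {..<n} \<times> {..<p}"
  define G where "G = std_gaussian I"
  define V where "V = std_gaussian {..<p}"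
  define L where "L = measure_pmf (pmf_of_set {-1, 1::real})"
  define a where "a = small_radius"
  define \<kappa> where "\<kappa> = std_normal_tail 0"
  have \<kappa>: "\<kappa> > 0" unfolding \<kappa>_def by (rule std_normal_tail_pos)
  have a: "a > 0" "4 * a = \<kappa> / 2" using \<kappa> by (auto simp: a_def small_radius_def \<kappa>_def)
  interpret G: prob_space G unfolding G_def by (rule prob_space_std_gaussian)
  interpret V: prob_space V unfolding V_def by (rule prob_space_std_gaussian)
  interpret L: prob_space L unfolding L_def by (rule prob_space_measure_pmf)
  interpret GG: pair_prob_space G G ..
  interpret VL: pair_prob_space V L ..
  have model: "model n p = (G \<Otimes>\<^sub>M G) \<Otimes>\<^sub>M (V \<Otimes>\<^sub>M L)"
    by (simp add: model_def G_def V_def L_def I_def)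
  have fin: "finite I" by (simp add: I_def)
  define Q where "Q = {\<omega> \<in> space (model n p). sgn (score n p d h t \<omega>) \<noteq> snd (snd \<omega>)}"
  have Q: "Q \<in> sets ((G \<Otimes>\<^sub>M G) \<Otimes>\<^sub>M (V \<Otimes>\<^sub>M L))"
  proof -
    note [measurable] = measurable_score measurable_model_coordinates(4)
    show ?thesis unfolding Q_def model[symmetric] by measurable
  qed
  \<comment> \<open>For a fixed label \<open>l\<close>, the favourable new noise vectors are those in \<open>up l - small l\<close>. Since
    \<open>l\<^sup>2 = 1\<close>, the coordinates of \<open>w + l \<theta>\<close> and \<open>\<theta> + l w\<close> have the same squares.\<close>
  define up where "up l = {w \<in> space V. (\<Sum>j<p. (l * t j) * w j) \<le> - 0}" for l
  define small where "small l = {w \<in> space V. (\<Sum>j<r. (w j - (- l * t j))\<^sup>2) \<le> a\<^sup>2 * real (card {..<r}) / 2}" for l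
  have Vm: "(\<lambda>w. w j) \<in> borel_measurable V" if "j < p" for j
    unfolding V_def using that by (intro measurable_coordinate_std_gaussian) auto
  have up_m: "up l \<in> sets V" for l
  proof -
    have "(\<lambda>w. \<Sum>j<p. (l * t j) * w j) \<in> borel_measurable V"
      by (intro borel_measurable_sum borel_measurable_times borel_measurable_const Vm) auto
    then show ?thesis unfolding up_def by measurable
  qed
  have small_m: "small l \<in> sets V" for l
  proof -
    have "(\<lambda>w. \<Sum>j<r. (w j - (- l * t j))\<^sup>2) \<in> borel_measurable V"
      using n by (intro borel_measurable_sum borel_measurable_power borel_measurable_diff borel_measurable_const Vm) auto
    then show ?thesis unfolding small_def by measurable
  qed
  have good: "\<kappa> / 2 \<le> measure V (up l - small l)" for l
  proof -
    have "\<kappa> \<le> measure V (up l)"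
      unfolding up_def V_def \<kappa>_def by (rule gaussian_linear_form_tail) auto
    moreover have "measure V (small l) \<le> 4 * a"
      unfolding small_def V_def
      by (rule std_gaussian_shifted_norm_small) (use n a in auto)
    moreover have "measure V (up l) \<le> measure V ((up l - small l) \<union> small l)"
      using up_m small_m by (intro V.finite_measure_mono) auto
    moreover have "\<dots> \<le> measure V (up l - small l) + measure V (small l)"
      using up_m small_m by (intro measure_Un_le) auto
    ultimately show ?thesis using a(2) by linarith
  qed
  define A where "A = (up 1 - small 1) \<times> {1} \<union> (up (-1) - small (-1)) \<times> {-1::real}"
  have A: "A \<in> sets (V \<Otimes>\<^sub>M L)"
    unfolding A_def by (intro sets.Un pair_measureI sets.Diff up_m small_m) (auto simp: L_def)
  have "1 * (\<kappa> / 2) \<le> measure (V \<Otimes>\<^sub>M L) A"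
  proof (rule measure_pair_ge_of_sections[OF V.prob_space_axioms L.prob_space_axioms A])
    show "{-1, 1} \<in> sets L" by (simp add: L_def)
    show "1 \<le> measure L {-1, 1}"
      unfolding L_def by (subst measure_pmf_of_set) auto
    show "\<kappa> / 2 \<le> measure V ((\<lambda>x. (x, l)) -` A)" if "l \<in> {-1, 1}" for l
    proof -
      have "(\<lambda>x. (x, l)) -` A = up l - small l"
        using that by (auto simp: A_def)
      then show ?thesis using good by simp
    qed
  qed (use \<kappa> in auto)
  then have A_ge: "\<kappa> / 2 \<le> measure (V \<Otimes>\<^sub>M L) A" by simp
  have sec: "\<kappa> * std_normal_tail (3 / a) \<le> measure (G \<Otimes>\<^sub>M G) ((\<lambda>x. (x, y)) -` Q)" if "y \<in> A" for y
  proof -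
    obtain w l where y: "y = (w, l)" by (cases y)
    have l: "l \<in> {-1, 1}" and w: "w \<in> up l" "w \<notin> small l"
      using that by (auto simp: y A_def)
    have ll: "l * l = 1" using l by auto
    have hh: "h i * h i = 1" if "i < n" for i using h[OF that] by auto
    \<comment> \<open>The coefficients of the two noise arrays, and the signal to be overcome.\<close>
    define c where "c ij = h (fst ij) * (t (snd ij) + l * w (snd ij))" for ij :: "nat \<times> nat"
    define e where "e ij = h (fst ij) * d (snd ij) * (t (snd ij) + l * w (snd ij))" for ij :: "nat \<times> nat"
    define m where "m = real n * (\<Sum>j<p. (t j)\<^sup>2)"
    define BW where "BW = {x \<in> space G. (\<Sum>ij\<in>I. c ij * x ij) \<le> - 0}"
    define BE where "BE = {x \<in> space G. (\<Sum>ij\<in>I. e ij * x ij) \<le> - m}"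
    have Gm: "(\<lambda>x. x ij) \<in> borel_measurable G" if "ij \<in> I" for ij
      unfolding G_def using that by (rule measurable_coordinate_std_gaussian)
    have B_m: "BW \<in> sets G" "BE \<in> sets G"
    proof -
      have "(\<lambda>x. \<Sum>ij\<in>I. f ij * x ij) \<in> borel_measurable G" for f
        by (intro borel_measurable_sum borel_measurable_times borel_measurable_const Gm)
      note [measurable] = this
      show "BW \<in> sets G" "BE \<in> sets G" unfolding BW_def BE_def by measurable
    qed
    have BW: "\<kappa> \<le> measure G BW"
      unfolding BW_def G_def \<kappa>_def by (rule gaussian_linear_form_tail) (use fin in auto)
    have BE: "std_normal_tail (3 / a) \<le> measure G BE"
      unfolding BE_def G_def
    proof (rule gaussian_linear_form_tail[OF fin])
      define s where "s = (\<Sum>j<r. (w j - (- l * t j))\<^sup>2)"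
      have s: "a\<^sup>2 * real r / 2 \<le> s"
        using w by (auto simp: small_def up_def s_def)
      have "(\<Sum>ij\<in>I. (e ij)\<^sup>2) = (\<Sum>i<n. \<Sum>j<p. (h i * d j * (t j + l * w j))\<^sup>2)"
        by (simp add: I_def e_def sum.cartesian_product case_prod_unfold)
      also have "\<dots> = (\<Sum>i<n. \<Sum>j<p. if j < r then real n * (w j - (- l * t j))\<^sup>2 else 0)"
      proof (intro sum.cong refl)
        fix i j assume "i \<in> {..<n}" "j \<in> {..<p}"
        then have "(h i)\<^sup>2 = 1" "(d j)\<^sup>2 = (if j < r then real n else 0)"
          using hh d by (auto simp: power2_eq_square)
        moreover have "(t j + l * w j)\<^sup>2 = (w j - (- l * t j))\<^sup>2"
          using l by (auto simp: power2_eq_square algebra_simps)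
        ultimately show "(h i * d j * (t j + l * w j))\<^sup>2
            = (if j < r then real n * (w j - (- l * t j))\<^sup>2 else 0)"
          by (simp add: power_mult_distrib)
      qed
      also have "(\<Sum>j<p. if j < r then real n * (w j - (- l * t j))\<^sup>2 else 0) = real n * s"
      proof -
        have "{..<p} \<inter> {j. j < r} = {..<r}" using n by auto
        then show ?thesis by (simp add: sum.If_cases s_def sum_distrib_left)
      qed
      finally have S: "(\<Sum>ij\<in>I. (e ij)\<^sup>2) = (real n)\<^sup>2 * s" by (simp add: power2_eq_square)
      have "real n \<le> (3 / a)\<^sup>2 * s"
      proof -
        have "real n \<le> (9 / a\<^sup>2) * (a\<^sup>2 * real r / 2)" using a n by simp
        also have "\<dots> \<le> (9 / a\<^sup>2) * s" using s by (intro mult_left_mono) auto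
        finally show ?thesis by (simp add: power_divide)
      qed
      then have "sqrt (real n) \<le> sqrt ((3 / a)\<^sup>2 * s)" by simp
      also have "\<dots> = 3 / a * sqrt s" using a by (simp add: real_sqrt_mult)
      finally have "real n * sqrt (real n) \<le> real n * (3 / a * sqrt s)"
        by (intro mult_left_mono) auto
      moreover have "m \<le> real n * sqrt (real n)"
        unfolding m_def using t by (intro mult_left_mono) auto
      ultimately show "m \<le> 3 / a * sqrt (\<Sum>ij\<in>I. (e ij)\<^sup>2)"
        unfolding S by (simp add: real_sqrt_mult mult_ac)
    qed
    have sub: "BW \<times> BE \<subseteq> (\<lambda>x. (x, y)) -` Q"
    proof (rule subsetI)
      fix x assume "x \<in> BW \<times> BE"
      then obtain W E where x: "x = (W, E)" and W: "W \<in> BW" and E: "E \<in> BE" by blast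
      have "real n * (\<Sum>j<p. (l * t j) * w j) \<le> 0"
        using w by (intro mult_nonneg_nonpos) (auto simp: up_def)
      then have "l * score n p d h t ((W, E), (w, l)) \<le> 0"
        using W E label_times_score[where l=l and h=h and n=n, OF ll hh, of p d t W E w]
        by (simp add: BW_def BE_def c_def e_def m_def I_def)
      then have "sgn (score n p d h t ((W, E), (w, l))) \<noteq> l"
        using l by (auto simp: sgn_if split: if_splits)
      moreover have "((W, E), (w, l)) \<in> space (model n p)"
        using W E w unfolding model space_pair_measure
        by (auto simp: BW_def BE_def up_def L_def)
      ultimately show "x \<in> (\<lambda>x. (x, y)) -` Q" by (simp add: Q_def x y)
    qed
    have "\<kappa> * std_normal_tail (3 / a) \<le> measure G BW * measure G BE"
      using BW BE \<kappa> std_normal_tail_pos[of "3 / a"] by (intro mult_mono) auto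
    also have "\<dots> = measure (G \<Otimes>\<^sub>M G) (BW \<times> BE)"
      by (rule measure_pair_Times[symmetric]) (use B_m G.prob_space_axioms in auto)
    also have "\<dots> \<le> measure (G \<Otimes>\<^sub>M G) ((\<lambda>x. (x, y)) -` Q)"
      using sub sets_Pair2[OF Q] by (intro GG.finite_measure_mono) auto
    finally show ?thesis .
  qed
  have "\<kappa> / 2 * (\<kappa> * std_normal_tail (3 / a)) \<le> measure ((G \<Otimes>\<^sub>M G) \<Otimes>\<^sub>M (V \<Otimes>\<^sub>M L)) Q"
    by (rule measure_pair_ge_of_sections[OF GG.prob_space_axioms VL.prob_space_axioms Q A A_ge _ sec])
      (use \<kappa> std_normal_tail_pos[of "3 / a"] in auto)
  then show ?thesis
    by (simp add: error_bound_def \<kappa>_def a_def Q_def model)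
qed

section \<open>The classifiers\<close>

lemma corruption_matrix_diag:
  assumes "j < p" "r \<le> p"
  shows "corruption_matrix n p r $$ (j, j) = (if j < r then real n else 0)"
proof -
  have "(\<Sum>i<r. unit_vec p i $ j * unit_vec p i $ j) = (\<Sum>i<r. if i = j then 1 else 0 :: real)"
    using assms by (intro sum.cong) (auto simp: unit_vec_def)
  then show ?thesis using assms(1) by (simp add: corruption_matrix_def)
qed

lemma corrupted_obs_index:
  assumes "j < p" "r \<le> p" "\<theta> \<in> carrier_vec p"
  shows "corrupted_obs p (corruption_matrix n p r) \<theta> \<eta> i \<omega> $ j =
    \<eta> $ i * \<theta> $ j + fst (fst \<omega>) (i, j) + (if j < r then sqrt (real n) else 0) * snd (fst \<omega>) (i, j)"
proof -
  let ?A = "corruption_matrix n p r"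
  have dim: "dim_row ?A = p" by (simp add: corruption_matrix_def)
  have "(diag_sqrt ?A *\<^sub>v corruption_noise p i \<omega>) $ j
      = (\<Sum>k\<in>{0..<p}. (if j = k then sqrt (?A $$ (k, k)) else 0) * snd (fst \<omega>) (i, k))"
    using assms(1) dim
    by (simp add: diag_sqrt_def mat_diag_def scalar_prod_def corruption_noise_def)
  also have "\<dots> = (\<Sum>k\<in>{0..<p}. if j = k then sqrt (?A $$ (k, k)) * snd (fst \<omega>) (i, k) else 0)"
    by (intro sum.cong) auto
  also have "\<dots> = (if j < r then sqrt (real n) else 0) * snd (fst \<omega>) (i, j)"
    using assms by (simp add: corruption_matrix_diag)
  finally show ?thesis
    using assms dim by (simp add: corrupted_obs_def clean_obs_def noise_def diag_sqrt_def mat_diag_def)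
qed

lemma corrupted_obs_carrier:
  "corrupted_obs p (corruption_matrix n p r) \<theta> \<eta> i \<omega> \<in> carrier_vec p"
proof (rule carrier_vecI)
  have "dim_row (corruption_matrix n p r) = p" by (simp add: corruption_matrix_def)
  then show "dim_vec (corrupted_obs p (corruption_matrix n p r) \<theta> \<eta> i \<omega>) = p"
    by (simp add: corrupted_obs_def diag_sqrt_def mat_diag_def)
qed

lemma ave_rule_eq_sgn_score:
  assumes "r \<le> p" "\<theta> \<in> carrier_vec p"
  shows "ave_rule n p \<eta> (\<lambda>i. corrupted_obs p (corruption_matrix n p r) \<theta> \<eta> i \<omega>) (new_obs p \<theta> \<omega>)
    = sgn (score n p (\<lambda>j. if j < r then sqrt (real n) else 0) (\<lambda>i. \<eta> $ i) (\<lambda>j. \<theta> $ j) \<omega>)"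
proof -
  let ?Y = "\<lambda>i. corrupted_obs p (corruption_matrix n p r) \<theta> \<eta> i \<omega>"
  have dim: "dim_vec (new_obs p \<theta> \<omega>) = p"
    by (simp add: new_obs_def new_noise_def)
  have "finsum_vec TYPE(real) p (\<lambda>i. \<eta> $ i \<cdot>\<^sub>v ?Y i) {..<n} $ j
      = (\<Sum>i<n. \<eta> $ i * (\<eta> $ i * \<theta> $ j + fst (fst \<omega>) (i, j)
        + (if j < r then sqrt (real n) else 0) * snd (fst \<omega>) (i, j)))" if j: "j < p" for j
  proof -
    have "finsum_vec TYPE(real) p (\<lambda>i. \<eta> $ i \<cdot>\<^sub>v ?Y i) {..<n} $ j
      = (\<Sum>i<n. (\<eta> $ i \<cdot>\<^sub>v ?Y i) $ j)"
      using j corrupted_obs_carrier by (intro index_finsum_vec) auto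
    also have "\<dots> = (\<Sum>i<n. \<eta> $ i * ?Y i $ j)"
    proof (rule sum.cong[OF refl])
      fix i
      have "j < dim_vec (?Y i)"
        unfolding carrier_vecD[OF corrupted_obs_carrier] by (rule j)
      then show "(\<eta> $ i \<cdot>\<^sub>v ?Y i) $ j = \<eta> $ i * ?Y i $ j"
        by (rule index_smult_vec(1))
    qed
    finally show ?thesis unfolding corrupted_obs_index[OF j assms] .
  qed
  moreover have "new_obs p \<theta> \<omega> $ j = snd (snd \<omega>) * \<theta> $ j + fst (snd \<omega>) j" if "j < p" for j
    using that assms by (simp add: new_obs_def new_noise_def new_label_def)
  ultimately have "finsum_vec TYPE(real) p (\<lambda>i. \<eta> $ i \<cdot>\<^sub>v ?Y i) {..<n} \<bullet> new_obs p \<theta> \<omega>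
      = score n p (\<lambda>j. if j < r then sqrt (real n) else 0) (\<lambda>i. \<eta> $ i) (\<lambda>j. \<theta> $ j) \<omega>"
    unfolding scalar_prod_def dim score_def atLeast0LessThan
    by (intro sum.cong refl) (simp only: lessThan_iff)
  then show ?thesis
    unfolding ave_rule_def by (rule arg_cong)
qed

lemma mat_inverse_one: "the (mat_inverse (1\<^sub>m p :: 'a :: field mat)) = 1\<^sub>m p"
proof (cases "mat_inverse (1\<^sub>m p :: 'a mat)")
  case None
  then have "(1\<^sub>m p :: 'a mat) \<notin> Units (ring_mat TYPE('a) p ())"
    by (rule mat_inverse(1)[OF one_carrier_mat])
  then show ?thesis by (auto simp: Units_def ring_mat_def)
next
  case (Some B)
  then show ?thesis using mat_inverse(2)[of "1\<^sub>m p :: 'a mat" p B] by auto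
qed

lemma lda_rule_identity_covariance:
  assumes "\<And>i. Y i \<in> carrier_vec p"
  shows "lda_rule n p (1\<^sub>m p) \<eta> Y = ave_rule n p \<eta> Y"
proof -
  have "finsum_vec TYPE(real) p (\<lambda>i. \<eta> $ i \<cdot>\<^sub>v Y i) {..<n} \<in> carrier_vec p"
    using assms by (intro finsum_vec_closed) auto
  then show ?thesis
    by (auto simp: lda_rule_def ave_rule_def mat_inverse_one)
qed

text \<open>
  Needed for the tower property: the conditional expectation defining the risk has its usual meaning
  only with respect to a sub-\<open>\<sigma>\<close>-algebra, that is if the observed data are measurable.
\<close>

lemma subalgebra_training_algebra:
  assumes "r \<le> p" "\<theta> \<in> carrier_vec p"
  shows "subalgebra (model n p) (training_algebra n p (corruption_matrix n p r) \<theta> \<eta>)"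
proof -
  let ?f = "\<lambda>\<omega>. \<lambda>(i, j)\<in>{..<n} \<times> {..<p}. corrupted_obs p (corruption_matrix n p r) \<theta> \<eta> i \<omega> $ j"
  let ?P = "\<Pi>\<^sub>M ij\<in>{..<n} \<times> {..<p}. (borel :: real measure)"
  have f: "?f \<in> measurable (model n p) ?P"
  proof (rule measurable_restrict)
    fix ij assume "ij \<in> {..<n} \<times> {..<p}"
    then obtain i j where ij: "ij = (i, j)" "i < n" "j < p" by auto
    have "(\<lambda>\<omega>. corrupted_obs p (corruption_matrix n p r) \<theta> \<eta> i \<omega> $ j) \<in> borel_measurable (model n p)"
      unfolding corrupted_obs_index[OF ij(3) assms]
      using ij by (intro borel_measurable_add borel_measurable_times borel_measurable_const
        measurable_model_coordinates)
    then show "(\<lambda>\<omega>. case ij of (i, j) \<Rightarrow> corrupted_obs p (corruption_matrix n p r) \<theta> \<eta> i \<omega> $ j)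
        \<in> borel_measurable (model n p)"
      by (simp add: ij)
  qed
  then have "?f \<in> space (model n p) \<rightarrow> space ?P"
    by (auto dest: measurable_space)
  from sets_vimage_algebra2[OF this] f show ?thesis
    unfolding subalgebra_def training_algebra_def by (auto intro: measurable_sets)
qed

text \<open>
  The tower property: averaging the conditional error probability over the training data gives back
  the probability of the error event.
\<close>

lemma integral_risk:
  assumes "r \<le> p" "\<theta> \<in> carrier_vec p"
    and E: "{\<omega> \<in> space (model n p).
      rule (\<lambda>i. corrupted_obs p (corruption_matrix n p r) \<theta> \<eta> i \<omega>) (new_obs p \<theta> \<omega>) \<noteq> new_label \<omega>} = E"
    and "E \<in> sets (model n p)"
  shows "(\<integral>\<omega>. risk n p (corruption_matrix n p r) \<theta> \<eta> rule \<omega> \<partial>model n p) = measure (model n p) E"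
proof -
  interpret prob_space "model n p" by (rule prob_space_model)
  interpret finite_measure_subalgebra "model n p" "training_algebra n p (corruption_matrix n p r) \<theta> \<eta>"
    by unfold_locales (rule subalgebra_training_algebra[OF assms(1,2)])
  have "integrable (model n p) (indicator E :: sample \<Rightarrow> real)"
    using assms(4) by (intro integrable_real_indicator) (auto simp: emeasure_eq_measure)
  from real_cond_exp_int(2)[OF this] show ?thesis
    using assms(4) by (simp add: risk_def E)
qed

theorem proposition5p1:
  shows "\<exists>C::real. C > 0 \<and>
    (\<forall>(n::nat) (p::nat) (r::nat) (\<eta>::real vec) (\<theta>::real vec) (A::real mat).
       n \<ge> 1 \<longrightarrow> p \<ge> 1 \<longrightarrow> n = 4 * r \<longrightarrow> r \<le> p \<longrightarrow>
       \<eta> \<in> carrier_vec n \<longrightarrow> (\<forall>i<n. \<eta> $ i \<in> {-1, 1}) \<longrightarrow>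
       A = corruption_matrix n p r \<longrightarrow>
       \<theta> \<in> carrier_vec p \<longrightarrow> \<theta> \<bullet> \<theta> \<le> sqrt (real n) \<longrightarrow>
       min (\<integral>\<omega>. risk n p A \<theta> \<eta> (lda_rule n p (1\<^sub>m p) \<eta>) \<omega> \<partial>model n p)
           (\<integral>\<omega>. risk n p A \<theta> \<eta> (ave_rule n p \<eta>) \<omega> \<partial>model n p) \<ge> C)"
proof (intro exI[of _ error_bound] conjI allI impI)
  show "error_bound > 0" by (rule error_bound_pos)
next
  fix n p r :: nat and \<eta> \<theta> :: "real vec" and A :: "real mat"
  assume n: "n \<ge> 1" "n = 4 * r" "r \<le> p"
    and \<eta>: "\<forall>i<n. \<eta> $ i \<in> {-1, 1}"
    and A: "A = corruption_matrix n p r"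
    and \<theta>: "\<theta> \<in> carrier_vec p" "\<theta> \<bullet> \<theta> \<le> sqrt (real n)"
  define s where "s = score n p (\<lambda>j. if j < r then sqrt (real n) else 0) (\<lambda>i. \<eta> $ i) (\<lambda>j. \<theta> $ j)"
  define E where "E = {\<omega> \<in> space (model n p). sgn (s \<omega>) \<noteq> snd (snd \<omega>)}"
  note [measurable] = measurable_score measurable_model_coordinates(4)
  have E: "E \<in> sets (model n p)"
    unfolding E_def s_def by measurable
  have "(\<Sum>j<p. (\<theta> $ j)\<^sup>2) \<le> sqrt (real n)"
    using \<theta> by (simp add: scalar_prod_def atLeast0LessThan power2_eq_square)
  then have bound: "error_bound \<le> measure (model n p) E"
    unfolding E_def s_def using n \<eta> by (intro misclassification_probability_ge) auto
  have "(\<integral>\<omega>. risk n p A \<theta> \<eta> (ave_rule n p \<eta>) \<omega> \<partial>model n p) = measure (model n p) E"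
    unfolding A by (rule integral_risk[OF n(3) \<theta>(1) _ E])
      (simp add: ave_rule_eq_sgn_score[OF n(3) \<theta>(1)] E_def s_def new_label_def)
  moreover have "(\<integral>\<omega>. risk n p A \<theta> \<eta> (lda_rule n p (1\<^sub>m p) \<eta>) \<omega> \<partial>model n p) = measure (model n p) E"
    unfolding A by (rule integral_risk[OF n(3) \<theta>(1) _ E])
      (simp add: lda_rule_identity_covariance[OF corrupted_obs_carrier]
        ave_rule_eq_sgn_score[OF n(3) \<theta>(1)] E_def s_def new_label_def)
  ultimately show "error_bound \<le>
      min (\<integral>\<omega>. risk n p A \<theta> \<eta> (lda_rule n p (1\<^sub>m p) \<eta>) \<omega> \<partial>model n p)
        (\<integral>\<omega>. risk n p A \<theta> \<eta> (ave_rule n p \<eta>) \<omega> \<partial>model n p)"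
    using bound by simp
qed

end
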